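(* For any positive integers $m,n,g$, there exists a sequence of collapses leading from the cubical complex $TF_{m,n,g}$ to its subcomplex consisting of all thin flips.
   Context: Torus fronts. Let $N=(0,1)$ (northbound step) and $E=(1,0)$ (eastbound step). Consider bi-infinite lattice paths in $\mathbb Z^2$ with steps $N$ and $E$, meeting each line $x+y=k$ ($k\in\mathbb Z$) in one vertex, and invariant under translation by $(n,m)$, so that each period has $m$ northbound and $n$ eastbound steps. An $(m,n)$-torus front is an equivalence class of such paths under translation by $(-1,1)$. Equivalently, it is a word $(s_i)_{i\in\mathbb Z/(m+n)}$ with $m$ letters $N$ and $n$ letters $E$, where $s_i$ is the step from the line $x+y=i-1$ to the line $x+y=i$. A sharp corner at position $i$ is a vertex with $s_i\ne s_{i+1}$. The elementary flip at $i$ interchanges $(s_i,s_{i+1})=(N,E)$ and $(E,N)$. Flips. A flip is given by a torus front and a set $I$ of positions of sharp corners, any two distinct elements of $I$ being at cyclic distance at least $2$ in $\mathbb Z/(m+n)$, where the orientation ($NE$ or $EN$) at each $i\in I$ is regarded as undetermined. Its members are the $2^{|I|}$ torus fronts obtained by choosing an orientation at each $i\in I$. (Flips at different positions are different, also when $m+n=2$.) The complex $TF_{m,n,g}$. Its vertices are the $(m,n)$-torus fronts all of whose horizontal legs have length at least $g$. That is, between any two cyclically consecutive northbound steps there are at least $g-1$ eastbound steps; the length of a leg is its number of vertices, and legs of length $1$ count. Its cubes are the flips all of whose members are vertices of $TF_{m,n,g}$. The flip with set $I$ is a cube of dimension $|I|$, whose faces are obtained by fixing the orientation at some positions in $I$.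 Width. For a torus front $T$, represented by a periodic path, consider the two lines of slope $m/n$ that are tangent to the path from the northwest and from the southeast. The width $w(T)$ is the distance between these lines measured along the line $x=-y$. Equivalently, $w(T)=\frac{\sqrt2}{m+n}(\max f-\min f)$, where $f(x,y)=ny-mx$ is evaluated on the vertices of the path. The width $w(F)$ of a flip $F$ is the maximum of the widths of its members. A flip (or torus front) is thin if its width is at most $\sqrt2$. *)

theory Defs
  imports Complex_Main
begin

datatype step = North | East

text \<open>A word indexed by \<open>\<int>/(m+n)\<close> is represented by an \<open>(m+n)\<close>-periodic function on \<open>\<int>\<close>;
  \<open>s i\<close> is the step from the line \<open>x + y = i - 1\<close> to the line \<open>x + y = i\<close>.\<close>

definition torus_front :: "nat \<Rightarrow> nat \<Rightarrow> (int \<Rightarrow> step) \<Rightarrow> bool" where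
  "torus_front m n s \<longleftrightarrow>
     (\<forall>i. s (i + (int m + int n)) = s i) \<and>
     card {i \<in> {0..<int m + int n}. s i = North} = m \<and>
     card {i \<in> {0..<int m + int n}. s i = East} = n"

text \<open>The vertex on the line \<open>x + y = k\<close> of the path with steps \<open>s\<close> through the origin. The other
  paths of the same front are its translates by multiples of \<open>(-1, 1)\<close>.\<close>

definition front_vertex :: "(int \<Rightarrow> step) \<Rightarrow> int \<Rightarrow> int \<times> int" where
  "front_vertex s k =
     (if 0 \<le> k
      then (int (card {i \<in> {1..k}. s i = East}), int (card {i \<in> {1..k}. s i = North}))
      else (- int (card {i \<in> {k+1..0}. s i = East}), - int (card {i \<in> {k+1..0}. s i = North})))"

lemma front_vertex_0: "front_vertex s 0 = (0, 0)"
  by (simp add: front_vertex_def)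

lemma front_vertex_step:
  "front_vertex s k =
     (case s k of
        North \<Rightarrow> (fst (front_vertex s (k - 1)), snd (front_vertex s (k - 1)) + 1)
      | East \<Rightarrow> (fst (front_vertex s (k - 1)) + 1, snd (front_vertex s (k - 1))))"
proof -
  have count: "int (card {i \<in> insert k A. s i = c}) =
      int (card {i \<in> A. s i = c}) + (if s k = c then 1 else 0)"
    if "finite A" "k \<notin> A" for A c
  proof -
    have "{i \<in> insert k A. s i = c} =
        (if s k = c then insert k {i \<in> A. s i = c} else {i \<in> A. s i = c})"
      by auto
    then show ?thesis using that by simp
  qed
  consider "1 \<le> k" | "k \<le> 0" by linarith
  then show ?thesis
  proof cases
    case 1
    then have "{1..k} = insert k {1..k - 1}" by auto
    then have "int (card {i \<in> {1..k}. s i = c}) =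
        int (card {i \<in> {1..k - 1}. s i = c}) + (if s k = c then 1 else 0)" for c
      using count[of "{1..k - 1}" c] by simp
    with 1 show ?thesis
      by (cases "s k") (simp_all add: front_vertex_def del: atLeastAtMost_iff)
  next
    case 2
    then have "{k..0} = insert k {k + 1..0}" by auto
    then have eq: "int (card {i \<in> {k..0}. s i = c}) =
        int (card {i \<in> {k + 1..0}. s i = c}) + (if s k = c then 1 else 0)" for c
      using count[of "{k + 1..0}" c] by simp
    have v: "front_vertex s k =
        (- int (card {i \<in> {k+1..0}. s i = East}), - int (card {i \<in> {k+1..0}. s i = North}))"
      using 2 by (cases "k = 0") (simp_all add: front_vertex_def)
    have v': "front_vertex s (k - 1) =
        (- int (card {i \<in> {k..0}. s i = East}), - int (card {i \<in> {k..0}. s i = North}))"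
      using 2 by (simp add: front_vertex_def del: atLeastAtMost_iff)
    show ?thesis
      unfolding v v' eq by (cases "s k") simp_all
  qed
qed

text \<open>A leg between two consecutive northbound steps has one vertex more than eastbound steps. The
  two northbound steps may be the same modulo \<open>m + n\<close>, which happens when \<open>m = 1\<close>.\<close>

definition long_legs :: "nat \<Rightarrow> (int \<Rightarrow> step) \<Rightarrow> bool" where
  "long_legs g s \<longleftrightarrow>
     (\<forall>i j. i < j \<and> s i = North \<and> s j = North \<and> (\<forall>k. i < k \<and> k < j \<longrightarrow> s k \<noteq> North) \<longrightarrow>
        g \<le> card {k. i < k \<and> k < j \<and> s k = East} + 1)"

definition cyclic_dist :: "int \<Rightarrow> int \<Rightarrow> int \<Rightarrow> int" where
  "cyclic_dist L i j = min ((i - j) mod L) ((j - i) mod L)"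

definition flip_positions :: "nat \<Rightarrow> nat \<Rightarrow> (int \<Rightarrow> step) \<Rightarrow> int set \<Rightarrow> bool" where
  "flip_positions m n s I \<longleftrightarrow>
     I \<subseteq> {0..<int m + int n} \<and>
     (\<forall>i\<in>I. s i \<noteq> s (i + 1)) \<and>
     (\<forall>i\<in>I. \<forall>j\<in>I. i \<noteq> j \<longrightarrow> 2 \<le> cyclic_dist (int m + int n) i j)"

definition flip_members :: "nat \<Rightarrow> nat \<Rightarrow> (int \<Rightarrow> step) \<Rightarrow> int set \<Rightarrow> (int \<Rightarrow> step) set" where
  "flip_members m n s I =
     {t. torus_front m n t \<and>
         (\<forall>i\<in>I. t i \<noteq> t (i + 1)) \<and>
         (\<forall>j. (\<forall>i\<in>I. j mod (int m + int n) \<noteq> i mod (int m + int n) \<and>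
                    j mod (int m + int n) \<noteq> (i + 1) mod (int m + int n)) \<longrightarrow> t j = s j)}"

text \<open>A flip is recorded by its positions together with its members, since for \<open>m + n = 2\<close> the
  flips at the two positions have the same members.\<close>

type_synonym flip = "int set \<times> (int \<Rightarrow> step) set"

definition flip_dim :: "flip \<Rightarrow> nat" where
  "flip_dim F = card (fst F)"

definition flip_face :: "flip \<Rightarrow> flip \<Rightarrow> bool" where
  "flip_face F G \<longleftrightarrow>
     fst F \<subseteq> fst G \<and>
     (\<exists>c :: int \<Rightarrow> step. snd F = {t \<in> snd G. \<forall>i \<in> fst G - fst F. t i = c i})"

definition TF :: "nat \<Rightarrow> nat \<Rightarrow> nat \<Rightarrow> flip set" where
  "TF m n g =
     {(I, flip_members m n s I) | s I.
        torus_front m n s \<and> flip_positions m n s I \<and>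
        (\<forall>t \<in> flip_members m n s I. long_legs g t)}"

text \<open>The tangent lines of slope \<open>m/n\<close> are \<open>n y - m x = c\<close> with \<open>c\<close> the maximum, respectively
  minimum, over the path; such a line meets \<open>x = -y\<close> in \<open>(-c/(m+n), c/(m+n))\<close>. The form
  \<open>n y - m x\<close> is invariant under translation by \<open>(n, m)\<close>, so it takes finitely many values on the
  vertices, and their differences do not depend on the path representing the front.\<close>

definition front_heights :: "nat \<Rightarrow> nat \<Rightarrow> (int \<Rightarrow> step) \<Rightarrow> int set" where
  "front_heights m n s =
     range (\<lambda>k. case front_vertex s k of (x, y) \<Rightarrow> int n * y - int m * x)"

definition front_width :: "nat \<Rightarrow> nat \<Rightarrow> (int \<Rightarrow> step) \<Rightarrow> real" where
  "front_width m n s =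
     sqrt 2 / real (m + n) * real_of_int (Max (front_heights m n s) - Min (front_heights m n s))"

definition flip_width :: "nat \<Rightarrow> nat \<Rightarrow> flip \<Rightarrow> real" where
  "flip_width m n F = Max (front_width m n ` snd F)"

definition thin_flip :: "nat \<Rightarrow> nat \<Rightarrow> flip \<Rightarrow> bool" where
  "thin_flip m n F \<longleftrightarrow> flip_width m n F \<le> sqrt 2"

text \<open>Removal of a free face \<open>F\<close> together with the only cube \<open>G\<close> of which it is a proper face.\<close>

definition elementary_collapse :: "flip set \<Rightarrow> flip set \<Rightarrow> bool" where
  "elementary_collapse X Y \<longleftrightarrow>
     (\<exists>F\<in>X. \<exists>G\<in>X. F \<noteq> G \<and> flip_face F G \<and> flip_dim G = flip_dim F + 1 \<and>
        (\<forall>H\<in>X. flip_face F H \<longrightarrow> H = F \<or> H = G) \<and>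
        Y = X - {F, G})"

definition collapses_to :: "flip set \<Rightarrow> flip set \<Rightarrow> bool" where
  "collapses_to = elementary_collapse\<^sup>*\<^sup>*"

end

theory Submission
  imports Defs
begin

text \<open>A flip is given by its highest path \<open>H\<close>, a periodic function of heights \<open>n y - m x\<close>, and a set
  \<open>I\<close> of peaks of \<open>H\<close>, each of which may be lowered by \<open>m + n\<close>. It is thin iff the lowest point of
  its lowest path is at most \<open>m + n\<close> below the maximum of \<open>H\<close>. Choose a position \<open>p\<close> where \<open>H\<close> is
  maximal, depending on \<open>H\<close> only, and match the fat flips \<open>I - {p}\<close> and \<open>I \<union> {p}\<close>: lowering the
  maximum of a fat flip does not produce a new lowest point. It does not make a leg too short either,
  since otherwise the next northbound step would end at height \<open>H p + n - m (g - 1)\<close>, whence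
  \<open>n \<le> m (g - 1)\<close>, and then all legs have length \<open>g\<close> and every front is thin.

  The area between \<open>H\<close> and the horizontal line through the lowest point of the flip grows from a face
  to a coface, strictly if \<open>H\<close> changes, and agrees on matched flips. Hence matched pairs can be removed
  in decreasing order of this area plus the dimension.\<close>

section \<open>Periodic functions and collapses along a matching\<close>

lemma periodic_mod:
  fixes f :: "int \<Rightarrow> 'a"
  assumes "\<And>k. f (k + L) = f k"
  shows "f (k mod L) = f k"
proof -
  have "f (x + z * L) = f x" for x z
  proof (induction z rule: int_induct[where k = 0])
    case (step1 i)
    then show ?case using assms[of "x + i * L"] by (simp add: algebra_simps)
  next
    case (step2 i)
    then show ?case using assms[of "x + (i - 1) * L"] by (simp add: algebra_simps)
  qed simp
  from this[of "k mod L" "k div L"] show ?thesis by simp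
qed

lemma same_differences:
  fixes f h :: "int \<Rightarrow> int"
  assumes "\<And>k. f k - f (k - 1) = h k - h (k - 1)"
  shows "f k = h k + (f 0 - h 0)"
proof (induction k rule: int_induct[where k = 0])
  case (step1 i)
  then show ?case using assms[of "i + 1"] by simp
next
  case (step2 i)
  then show ?case using assms[of i] by simp
qed simp

text \<open>The acyclic matching principle of discrete Morse theory. In a pair with the largest
  \<open>r\<close> the face \<open>F q\<close> is free: a further coface would lie in
  \<open>Y\<close>, which is excluded, or in a pair with larger \<open>r\<close>. Removing that pair
  leaves a smaller matching.\<close>

lemma collapses_to_by_matching:
  fixes F G :: "'a \<Rightarrow> flip" and r :: "'a \<Rightarrow> int"
  assumes "finite Q"
    and "\<And>q. q \<in> Q \<Longrightarrow> F q \<noteq> G q \<and> flip_face (F q) (G q) \<and> flip_dim (G q) = flip_dim (F q) + 1"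
    and "\<And>q. q \<in> Q \<Longrightarrow> F q \<notin> Y \<and> G q \<notin> Y"
    and "\<And>q q'. q \<in> Q \<Longrightarrow> q' \<in> Q \<Longrightarrow> q \<noteq> q' \<Longrightarrow> {F q, G q} \<inter> {F q', G q'} = {}"
    and "\<And>q H. q \<in> Q \<Longrightarrow> H \<in> Y \<Longrightarrow> \<not> flip_face (F q) H"
    and "\<And>q q' H. q \<in> Q \<Longrightarrow> q' \<in> Q \<Longrightarrow> H \<in> {F q', G q'} \<Longrightarrow> flip_face (F q) H \<Longrightarrow> q \<noteq> q' \<Longrightarrow> r q < r q'"
  shows "collapses_to (Y \<union> F ` Q \<union> G ` Q) Y"
  using assms
proof (induction "card Q" arbitrary: Q)
  case 0
  then show ?case by (simp add: collapses_to_def)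
next
  case (Suc c)
  note Q = Suc.prems
  from \<open>Suc c = card Q\<close> have "Q \<noteq> {}" by auto
  with \<open>finite Q\<close> have "Max (r ` Q) \<in> r ` Q" by simp
  then obtain q where q: "q \<in> Q" "r q = Max (r ` Q)" by auto
  have r_le: "r q' \<le> r q" if "q' \<in> Q" for q'
    using \<open>finite Q\<close> that q(2) by simp
  let ?X = "Y \<union> F ` Q \<union> G ` Q"
  let ?X' = "Y \<union> F ` (Q - {q}) \<union> G ` (Q - {q})"
  have "?X' = ?X - {F q, G q}"
  proof
    show "?X' \<subseteq> ?X - {F q, G q}"
      using Q(3)[OF q(1)] Q(4)[OF q(1)] by fastforce
    show "?X - {F q, G q} \<subseteq> ?X'" by auto
  qed
  moreover have "H = F q \<or> H = G q" if "H \<in> ?X" "flip_face (F q) H" for H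
  proof (rule ccontr)
    assume ne: "\<not> ?thesis"
    from that Q(5)[OF q(1)] have "H \<notin> Y" by blast
    with that(1) obtain q' where q': "q' \<in> Q" "H \<in> {F q', G q'}" by auto
    with ne have "q \<noteq> q'" by auto
    from Q(6)[OF q(1) q' that(2) this] r_le[OF q'(1)] show False by simp
  qed
  ultimately have "elementary_collapse ?X ?X'"
    unfolding elementary_collapse_def using q(1) Q(2)[OF q(1)]
    by (intro bexI[of _ "F q"] bexI[of _ "G q"]) auto
  moreover have "collapses_to ?X' Y"
  proof (rule Suc.hyps(1))
    show "c = card (Q - {q})" using Suc.hyps(2) q(1) \<open>finite Q\<close> by simp
  qed (use Q in \<open>auto\<close>)
  ultimately show ?case
    unfolding collapses_to_def by (rule converse_rtranclp_into_rtranclp)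
qed

section \<open>Leg lengths as distances between northbound steps\<close>

lemma neq_North_iff: "a \<noteq> North \<longleftrightarrow> a = East"
  by (cases a) auto

text \<open>Between consecutive northbound steps all steps go east, so the leg has
  \<open>j - i\<close> vertices. Any other pair of northbound steps is farther apart than a
  consecutive pair between them.\<close>

lemma long_legs_iff:
  "long_legs g s \<longleftrightarrow> (\<forall>i j. i < j \<and> s i = North \<and> s j = North \<longrightarrow> int g \<le> j - i)"
    (is "?L \<longleftrightarrow> ?R")
proof -
  have card_eq: "int (card {k. i < k \<and> k < j \<and> s k = East}) + 1 = j - i"
    if "i < j" "\<forall>k. i < k \<and> k < j \<longrightarrow> s k \<noteq> North" for i j
  proof -
    have "{k. i < k \<and> k < j \<and> s k = East} = {i<..<j}"
      using that(2) by (auto simp: neq_North_iff)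
    then show ?thesis using that(1) by simp
  qed
  show ?thesis
  proof
    assume L: ?L
    have "int g \<le> j - i" if "i < j" "s i = North" "s j = North" for i j
      using that
    proof (induction "nat (j - i)" arbitrary: i rule: less_induct)
      case less
      show ?case
      proof (cases "\<exists>k. i < k \<and> k < j \<and> s k = North")
        case True
        then obtain k where k: "i < k" "k < j" "s k = North" by blast
        then have "int g \<le> j - k" using less by simp
        with k show ?thesis by simp
      next
        case False
        then have "g \<le> card {k. i < k \<and> k < j \<and> s k = East} + 1"
          using L less.prems unfolding long_legs_def by blast
        then show ?thesis using card_eq[of i j] less.prems(1) False by force
      qed
    qed
    then show ?R by blast
  next
    assume R: ?R
    show ?L unfolding long_legs_def
    proof (intro allI impI)
      fix i j
      assume a: "i < j \<and> s i = North \<and> s j = North \<and> (\<forall>k. i < k \<and> k < j \<longrightarrow> s k \<noteq> North)"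
      then have "int g \<le> j - i" using R by blast
      then show "g \<le> card {k. i < k \<and> k < j \<and> s k = East} + 1"
        using card_eq[of i j] a by force
    qed
  qed
qed

section \<open>Height functions of periodic paths and the lowering of peaks\<close>

locale torus =
  fixes m n :: nat
  assumes m_pos: "m > 0" and n_pos: "n > 0"
begin

abbreviation L :: int where "L \<equiv> int m + int n"

text \<open>The heights \<open>n y - m x\<close> along a periodic path: a northbound step adds \<open>n\<close>, an eastbound
  step subtracts \<open>m\<close>.\<close>

definition path :: "(int \<Rightarrow> int) \<Rightarrow> bool" where
  "path H \<longleftrightarrow> (\<forall>k. H k = H (k - 1) + int n \<or> H k = H (k - 1) - int m) \<and> (\<forall>k. H (k + L) = H k)"

definition word :: "(int \<Rightarrow> int) \<Rightarrow> int \<Rightarrow> step" where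
  "word H k = (if H k = H (k - 1) + int n then North else East)"

text \<open>Turning a corner from \<open>NE\<close> to \<open>EN\<close> replaces a rise by
  \<open>n\<close> with a descent by \<open>m\<close>, hence the drop \<open>L\<close>.\<close>

definition lower :: "int set \<Rightarrow> (int \<Rightarrow> int) \<Rightarrow> int \<Rightarrow> int" where
  "lower A H k = H k - (if k mod L \<in> A then L else 0)"

definition peaks :: "(int \<Rightarrow> int) \<Rightarrow> int set" where
  "peaks H = {i \<in> {0..<L}. H i = H (i - 1) + int n \<and> H (i + 1) = H i - int m}"

text \<open>\<open>H\<close> is the highest of the paths in the flip, which has a northeast corner at all positions
  in \<open>I\<close>; the other members lower it by \<open>m + n\<close> at the positions in a subset of \<open>I\<close>.\<close>

definition cube :: "(int \<Rightarrow> int) \<Rightarrow> int set \<Rightarrow> flip" where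
  "cube H I = (I, (\<lambda>A. word (lower A H)) ` Pow I)"

definition height :: "(int \<Rightarrow> step) \<Rightarrow> int \<Rightarrow> int" where
  "height s k = (case front_vertex s k of (x, y) \<Rightarrow> int n * y - int m * x)"

lemma L_pos: "L > 0" using m_pos by simp

lemma L_ge_2: "L \<ge> 2" using m_pos n_pos by simp

lemma path_step: "path H \<Longrightarrow> H k = H (k - 1) + int n \<or> H k = H (k - 1) - int m"
  by (simp add: path_def)

lemma path_mod: "path H \<Longrightarrow> H (k mod L) = H k"
  by (rule periodic_mod) (simp add: path_def)

lemma path_cong: "path H \<Longrightarrow> j mod L = k mod L \<Longrightarrow> H j = H k"
  by (metis path_mod)

lemma path_add_L: "path H \<Longrightarrow> H (k + L - c) = H (k - c)"
  by (simp add: path_def diff_add_eq[symmetric])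

lemma mod_shift: "j mod L = k mod L \<Longrightarrow> (j + c) mod L = (k + c) mod L"
  by (metis mod_add_left_eq)

lemma path_step_word:
  "path H \<Longrightarrow> H k - H (k - 1) = (if word H k = North then int n else - int m)"
  using path_step[of H k] by (auto simp: word_def)

text \<open>A word fixes the height differences but not the base height. The remaining constant is
  why cubes are later normalised by \<open>H 0 = 0\<close>.\<close>

lemma word_eqD:
  assumes "path H" "path K" "word H = word K"
  shows "H k = K k + (H 0 - K 0)"
  by (rule same_differences) (simp add: path_step_word assms)

lemma path_shift: "path H \<Longrightarrow> path (\<lambda>k. H k + c)"
  by (auto simp: path_def)

lemma word_shift: "word (\<lambda>k. H k + c) = word H"
  by (auto simp: word_def fun_eq_iff)

lemma lower_shift: "lower A (\<lambda>k. H k + c) = (\<lambda>k. lower A H k + c)"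
  by (auto simp: lower_def fun_eq_iff)

lemma peaks_shift: "peaks (\<lambda>k. H k + c) = peaks H"
  by (auto simp: peaks_def)

lemma cube_shift: "cube (\<lambda>k. H k + c) I = cube H I"
  by (simp add: cube_def lower_shift word_shift)

lemma lower_empty [simp]: "lower {} H = H"
  by (auto simp: lower_def)

lemma lower_lower: "A \<inter> B = {} \<Longrightarrow> lower A (lower B H) = lower (A \<union> B) H"
  by (auto simp: lower_def fun_eq_iff)

lemma lower_le: "lower A H k \<le> H k"
  using L_pos by (simp add: lower_def)

lemma lower_antimono: "A \<subseteq> B \<Longrightarrow> lower B H k \<le> lower A H k"
  using L_pos by (auto simp: lower_def)

lemma peak_modD:
  assumes "path H" "k mod L \<in> peaks H"
  shows "H k = H (k - 1) + int n" "H (k + 1) = H k - int m"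
proof -
  have "H (k mod L - 1) = H (k - 1)" "H (k mod L + 1) = H (k + 1)"
    by (rule path_cong[OF assms(1)], simp add: mod_diff_left_eq mod_add_left_eq)+
  with assms path_mod[OF assms(1), of k]
  show "H k = H (k - 1) + int n" "H (k + 1) = H k - int m"
    by (auto simp: peaks_def)
qed

text \<open>The step joining the two peaks would have to go both up and down. Thus subsets of
  \<open>peaks H\<close> satisfy the distance condition of flips.\<close>

lemma peaks_not_adjacent:
  assumes "path H" "k mod L \<in> peaks H" "(k - 1) mod L \<in> peaks H"
  shows False
  using peak_modD[OF assms(1,2)] peak_modD[OF assms(1,3)] n_pos m_pos by simp

text \<open>The rise before a lowered peak becomes \<open>n - L = - m\<close>, and the descent after
  it becomes \<open>L - m = n\<close>. As peaks are not adjacent, no step is changed at both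
  ends.\<close>

lemma path_lower:
  assumes "path H" "A \<subseteq> peaks H"
  shows "path (lower A H)"
  unfolding path_def
proof (intro conjI allI)
  fix k
  show "lower A H (k + L) = lower A H k"
    using assms(1) by (simp add: lower_def path_def)
  have "\<not> (k mod L \<in> A \<and> (k - 1) mod L \<in> A)"
    using peaks_not_adjacent[OF assms(1)] assms(2) by blast
  then consider "k mod L \<in> A" "(k - 1) mod L \<notin> A" | "k mod L \<notin> A" "(k - 1) mod L \<in> A"
    | "k mod L \<notin> A" "(k - 1) mod L \<notin> A" by blast
  then show "lower A H k = lower A H (k - 1) + int n \<or> lower A H k = lower A H (k - 1) - int m"
  proof cases
    case 1
    then show ?thesis using peak_modD[OF assms(1), of k] assms(2) by (auto simp: lower_def)
  next
    case 2
    then show ?thesis using peak_modD[OF assms(1), of "k - 1"] assms(2) by (auto simp: lower_def)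
  next
    case 3
    then show ?thesis using path_step[OF assms(1), of k] by (auto simp: lower_def)
  qed
qed

text \<open>Step \<open>k\<close> joins the positions \<open>k - 1\<close> and \<open>k\<close>. The
  cases are that its end, its start, or neither is a flip position.\<close>

lemma word_lower_at:
  assumes "path H" "I \<subseteq> peaks H" "A \<subseteq> I"
  shows "k mod L \<in> I \<Longrightarrow> word (lower A H) k = (if k mod L \<in> A then East else North)"
    and "(k - 1) mod L \<in> I \<Longrightarrow> word (lower A H) k = (if (k - 1) mod L \<in> A then North else East)"
    and "k mod L \<notin> I \<Longrightarrow> (k - 1) mod L \<notin> I \<Longrightarrow> word (lower A H) k = word H k"
proof -
  show "word (lower A H) k = (if k mod L \<in> A then East else North)" if "k mod L \<in> I"
  proof -
    have "(k - 1) mod L \<notin> A"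
      using peaks_not_adjacent[OF assms(1)] that assms(2,3) by blast
    then show ?thesis
      using peak_modD[OF assms(1), of k] that assms(2) L_pos by (auto simp: lower_def word_def)
  qed
  show "word (lower A H) k = (if (k - 1) mod L \<in> A then North else East)" if "(k - 1) mod L \<in> I"
  proof -
    have "k mod L \<notin> A"
      using peaks_not_adjacent[OF assms(1)] that assms(2,3) by blast
    then show ?thesis
      using peak_modD[OF assms(1), of "k - 1"] that assms(2) L_pos by (auto simp: lower_def word_def)
  qed
  show "k mod L \<notin> I \<Longrightarrow> (k - 1) mod L \<notin> I \<Longrightarrow> word (lower A H) k = word H k"
    using assms(3) by (auto simp: lower_def word_def)
qed

subsection \<open>Fronts and heights\<close>

lemma height_0 [simp]: "height s 0 = 0"
  by (simp add: height_def front_vertex_0)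

lemma height_step: "height s k - height s (k - 1) = (if s k = North then int n else - int m)"
proof -
  have eq: "height s j = int n * snd (front_vertex s j) - int m * fst (front_vertex s j)" for j
    by (simp add: height_def case_prod_beta)
  show ?thesis
    unfolding eq using front_vertex_step[of s k] by (cases "s k") (simp_all add: algebra_simps)
qed

lemma word_height [simp]: "word (height s) = s"
proof
  fix k
  show "word (height s) k = s k"
    using height_step[of s k] m_pos n_pos by (cases "s k") (auto simp: word_def)
qed

lemma height_word: "path H \<Longrightarrow> height (word H) k = H k - H 0"
  using same_differences[of "height (word H)" H k] by (simp add: height_step path_step_word)

text \<open>\<open>front_vertex\<close> counts over \<open>{1..L}\<close>, but
  \<open>torus_front\<close> counts over \<open>{0..<L}\<close>; reduction modulo \<open>L\<close>
  matches the two windows, sending \<open>L\<close> to \<open>0\<close>.\<close>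

lemma height_L:
  assumes "\<And>i. s (i + L) = s i"
  shows "height s L = int n * int (card {i \<in> {0..<L}. s i = North})
    - int m * int (card {i \<in> {0..<L}. s i = East})"
proof -
  have "card {i \<in> {1..L}. s i = c} = card {i \<in> {0..<L}. s i = c}" for c
  proof (rule bij_betw_same_card[of "\<lambda>i. i mod L"])
    show "bij_betw (\<lambda>i. i mod L) {i \<in> {1..L}. s i = c} {i \<in> {0..<L}. s i = c}"
    proof (rule bij_betw_byWitness[where f' = "\<lambda>i. if i = 0 then L else i"])
      show "\<forall>a\<in>{i \<in> {1..L}. s i = c}. (if a mod L = 0 then L else a mod L) = a"
      proof
        fix a assume "a \<in> {i \<in> {1..L}. s i = c}"
        then show "(if a mod L = 0 then L else a mod L) = a"
          by (cases "a = L") auto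
      qed
      show "\<forall>a'\<in>{i \<in> {0..<L}. s i = c}. (if a' = 0 then L else a') mod L = a'"
        by auto
      show "(\<lambda>i. i mod L) ` {i \<in> {1..L}. s i = c} \<subseteq> {i \<in> {0..<L}. s i = c}"
        using periodic_mod[of s L, OF assms] L_pos by auto
      show "(\<lambda>i. if i = 0 then L else i) ` {i \<in> {0..<L}. s i = c} \<subseteq> {i \<in> {1..L}. s i = c}"
        using assms[of 0] L_pos by auto
    qed
  qed
  then show ?thesis by (simp add: height_def front_vertex_def)
qed

lemma card_steps:
  "card {i \<in> {0..<L}. s i = North} + card {i \<in> {0..<L}. s i = East} = m + n"
proof -
  have "card {i \<in> {0..<L}. s i = North} + card {i \<in> {0..<L}. s i = East}
      = card ({i \<in> {0..<L}. s i = North} \<union> {i \<in> {0..<L}. s i = East})"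
    by (rule card_Un_disjoint[symmetric]; (rule finite_subset[of _ "{0..<L}"])?; auto)
  also have "{i \<in> {0..<L}. s i = North} \<union> {i \<in> {0..<L}. s i = East} = {0..<L}"
    by (auto simp flip: neq_North_iff)
  finally show ?thesis by simp
qed

text \<open>The first period climbs by \<open>n * m - m * n = 0\<close>, and the climb over a period
  does not depend on where it starts.\<close>

lemma path_height:
  assumes "torus_front m n s"
  shows "path (height s)"
proof -
  have per: "s (i + L) = s i" for i using assms by (simp add: torus_front_def)
  have "height s L = 0"
    using height_L[of s, OF per] assms by (simp add: torus_front_def)
  moreover have "height s (k + L) = height s k + (height s (0 + L) - height s 0)" for k
  proof (rule same_differences)
    fix k
    show "height s (k + L) - height s (k - 1 + L) = height s k - height s (k - 1)"
      using height_step[of s "k + L"] height_step[of s k] per[of k]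
      by (simp add: algebra_simps)
  qed
  ultimately have "height s (k + L) = height s k" for k by simp
  moreover have "height s k = height s (k - 1) + int n \<or> height s k = height s (k - 1) - int m" for k
    using height_step[of s k] by (auto split: if_splits)
  ultimately show ?thesis by (simp add: path_def)
qed

text \<open>Returning to the same height after \<open>L\<close> steps gives
  \<open>n * N = m * E\<close>; together with \<open>N + E = m + n\<close> this forces
  \<open>N = m\<close> and \<open>E = n\<close>.\<close>

lemma torus_front_word:
  assumes "path H"
  shows "torus_front m n (word H)"
proof -
  have per: "word H (i + L) = word H i" for i
    using path_add_L[OF assms, of i 0] path_add_L[OF assms, of i 1] by (simp add: word_def)
  define N where "N = card {i \<in> {0..<L}. word H i = North}"
  define E where "E = card {i \<in> {0..<L}. word H i = East}"
  have NE: "N + E = m + n" using card_steps[of "word H"] by (simp only: N_def E_def)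
  have "height (word H) L = 0"
    using height_word[OF assms, of L] path_cong[OF assms, of L 0] by simp
  then have "int n * int N = int m * int E"
    using height_L[of "word H", OF per] by (simp only: N_def E_def)
  then have "int (n * N) = int (m * E)" by simp
  then have "n * N = m * E" by (rule of_nat_eq_iff[THEN iffD1])
  then have "(m + n) * N = m * (N + E)" by (simp add: algebra_simps)
  then have "(m + n) * N = (m + n) * m" by (simp only: NE mult.commute)
  then have "N = m" using m_pos by auto
  moreover from this NE have "E = n" by simp
  ultimately show ?thesis using per by (simp add: torus_front_def N_def E_def)
qed

lemma finite_fronts: "finite {s. torus_front m n s}"
proof -
  let ?f = "\<lambda>s. {i \<in> {0..<L}. s i = North}"
  have "inj_on ?f {s. torus_front m n s}"
  proof (intro inj_onI ext)
    fix s t k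
    assume "s \<in> {s. torus_front m n s}" "t \<in> {s. torus_front m n s}" and eq: "?f s = ?f t"
    then have "s (k mod L) = s k" "t (k mod L) = t k"
      by (auto intro!: periodic_mod simp: torus_front_def)
    moreover have "k mod L \<in> {0..<L}" using L_pos by simp
    then have "s (k mod L) = North \<longleftrightarrow> t (k mod L) = North" using eq by blast
    ultimately show "s k = t k" by (cases "s k"; cases "t k") auto
  qed
  moreover have "finite (?f ` {s. torus_front m n s})"
    by (rule finite_subset[of _ "Pow {0..<L}"]) auto
  ultimately show ?thesis by (intro finite_imageD[of ?f])
qed

lemma finite_range_path:
  assumes "path H"
  shows "finite (range H)"
proof (rule finite_subset)
  show "range H \<subseteq> H ` {0..<L}"
  proof clarify
    fix k
    show "H k \<in> H ` {0..<L}"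
      by (rule image_eqI[of _ _ "k mod L"]) (use path_mod[OF assms, of k] L_pos in auto)
  qed
qed simp

text \<open>The normalising factor of the width cancels, and so does the base height
  \<open>H 0\<close>, so thinness becomes an integer bound on the oscillation of
  \<open>H\<close>.\<close>

lemma front_width_le_iff:
  assumes "path H"
  shows "front_width m n (word H) \<le> sqrt 2 \<longleftrightarrow> (\<forall>k l. H k - H l \<le> L)"
proof -
  let ?S = "front_heights m n (word H)"
  have S: "?S = range (\<lambda>k. H k - H 0)"
    using height_word[OF assms] by (simp add: front_heights_def height_def)
  then have fin: "finite ?S" "?S \<noteq> {}"
    using finite_range_path[OF path_shift[OF assms, of "- H 0"]] by auto
  have "front_width m n (word H) \<le> sqrt 2 \<longleftrightarrow>
      sqrt 2 * real_of_int (Max ?S - Min ?S) \<le> sqrt 2 * real (m + n)"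
    using m_pos by (simp add: front_width_def divide_le_eq del: mult_le_cancel_left_pos)
  also have "\<dots> \<longleftrightarrow> real_of_int (Max ?S - Min ?S) \<le> real_of_int L" by simp
  also have "\<dots> \<longleftrightarrow> Max ?S - Min ?S \<le> L" by (rule of_int_le_iff)
  also have "\<dots> \<longleftrightarrow> (\<forall>k l. H k - H l \<le> L)"
  proof
    assume le: "Max ?S - Min ?S \<le> L"
    show "\<forall>k l. H k - H l \<le> L"
    proof (intro allI)
      fix k l
      have "H k - H 0 \<le> Max ?S" "Min ?S \<le> H l - H 0" using fin S by auto
      with le show "H k - H l \<le> L" by simp
    qed
  next
    assume le: "\<forall>k l. H k - H l \<le> L"
    obtain k l where "Max ?S = H k - H 0" "Min ?S = H l - H 0"
      using Max_in[OF fin] Min_in[OF fin] S by auto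
    with le show "Max ?S - Min ?S \<le> L" by simp
  qed
  finally show ?thesis .
qed

subsection \<open>Cubes\<close>

text \<open>The front \<open>s\<close> is compared with \<open>H\<close> only away from the flip,
  because a flip may be presented by any of its members while \<open>H\<close> is its top.\<close>

lemma flip_members_eq:
  assumes H: "path H" "I \<subseteq> peaks H"
    and s: "\<And>j. j mod L \<notin> I \<Longrightarrow> (j - 1) mod L \<notin> I \<Longrightarrow> s j = word H j"
  shows "(I, flip_members m n s I) = cube H I"
proof -
  have I_mod: "i mod L = i" if "i \<in> I" for i
    using that H(2) by (auto simp: peaks_def)
  have off: "(\<forall>i\<in>I. j mod L \<noteq> i mod L \<and> j mod L \<noteq> (i + 1) mod L) \<longleftrightarrow>
      j mod L \<notin> I \<and> (j - 1) mod L \<notin> I" for j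
  proof -
    have "j mod L = (i + 1) mod L \<longleftrightarrow> (j - 1) mod L = i" if "i \<in> I" for i
      using mod_shift[of j "i + 1" "-1"] mod_shift[of "j - 1" i 1] I_mod[OF that] by auto
    then show ?thesis using I_mod by (auto 0 3)
  qed
  have "flip_members m n s I = (\<lambda>A. word (lower A H)) ` Pow I"
  proof
    show "flip_members m n s I \<subseteq> (\<lambda>A. word (lower A H)) ` Pow I"
    proof
      fix t
      assume "t \<in> flip_members m n s I"
      then have t: "torus_front m n t" "\<And>i. i \<in> I \<Longrightarrow> t i \<noteq> t (i + 1)"
        "\<And>j. j mod L \<notin> I \<Longrightarrow> (j - 1) mod L \<notin> I \<Longrightarrow> t j = s j"
        unfolding flip_members_def off by auto
      have per: "t (k mod L) = t k" for k
        using t(1) by (intro periodic_mod) (simp add: torus_front_def)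
      \<comment> \<open>East first at a flip position means the low corner \<open>EN\<close>, so
        these are the positions where \<open>t\<close> lies below the top.\<close>
      define A where "A = {i \<in> I. t i = East}"
      have A: "A \<subseteq> I" by (auto simp: A_def)
      have "t j = word (lower A H) j" for j
      proof -
        consider "j mod L \<in> I" | "(j - 1) mod L \<in> I" | "j mod L \<notin> I" "(j - 1) mod L \<notin> I" by blast
        then show ?thesis
        proof cases
          case 1
          then show ?thesis
            unfolding word_lower_at(1)[OF H A 1] using per[of j]
            by (cases "t j") (auto simp: A_def)
        next
          case 2
          have "t ((j - 1) mod L + 1) = t j"
            using per[of "(j - 1) mod L + 1"] per[of j] by (simp add: mod_add_left_eq)
          with t(2)[OF 2] have "t ((j - 1) mod L) \<noteq> t j" by simp
          then show ?thesis
            unfolding word_lower_at(2)[OF H A 2] using 2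
            by (cases "t j"; cases "t ((j - 1) mod L)") (auto simp: A_def)
        next
          case 3
          then show ?thesis using word_lower_at(3)[OF H A 3] t(3) s by simp
        qed
      qed
      with A show "t \<in> (\<lambda>A. word (lower A H)) ` Pow I" by blast
    qed
    show "(\<lambda>A. word (lower A H)) ` Pow I \<subseteq> flip_members m n s I"
    proof clarify
      fix A assume A: "A \<subseteq> I"
      have "torus_front m n (word (lower A H))"
        using torus_front_word path_lower H A by blast
      moreover have "word (lower A H) i \<noteq> word (lower A H) (i + 1)" if "i \<in> I" for i
        using word_lower_at(1)[OF H A, of i] word_lower_at(2)[OF H A, of "i + 1"] I_mod[OF that] that
        by auto
      moreover have "word (lower A H) j = s j" if "j mod L \<notin> I" "(j - 1) mod L \<notin> I" for j
        using word_lower_at(3)[OF H A that] s[OF that] by simp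
      ultimately show "word (lower A H) \<in> flip_members m n s I"
        unfolding flip_members_def off by auto
    qed
  qed
  then show ?thesis by (simp add: cube_def)
qed

lemma flip_positions_peaks:
  assumes "path H" "I \<subseteq> peaks H"
  shows "flip_positions m n (word H) I"
proof -
  have pk: "i \<in> {0..<L}" "i mod L = i" "i mod L \<in> peaks H" "i \<in> peaks H" if "i \<in> I" for i
    using that assms(2) by (auto simp: peaks_def)
  have "2 \<le> (i - j) mod L" if "i \<in> I" "j \<in> I" "i \<noteq> j" for i j
  proof -
    have "(i - j) mod L \<noteq> 0"
      using that pk(2)[of i] pk(2)[of j] mod_shift[of "i - j" 0 j] by auto
    moreover have "(i - j) mod L \<noteq> 1"
    proof
      assume "(i - j) mod L = 1"
      then have "(i - j) mod L = 1 mod L" using L_ge_2 by simp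
      then have "(i - 1) mod L = j" using mod_shift[of "i - j" 1 "j - 1"] pk(2)[of j] that by simp
      then show False using peaks_not_adjacent[OF assms(1), of i] pk(3,4) that by simp
    qed
    moreover have "0 \<le> (i - j) mod L" using L_pos by simp
    ultimately show ?thesis by linarith
  qed
  moreover have "word H i \<noteq> word H (i + 1)" if "i \<in> I" for i
    using pk(4)[OF that] L_pos by (auto simp: peaks_def word_def)
  ultimately show ?thesis
    using pk(1) by (auto simp: flip_positions_def cyclic_dist_def)
qed

definition all_long :: "nat \<Rightarrow> (int \<Rightarrow> int) \<Rightarrow> int set \<Rightarrow> bool" where
  "all_long g H I \<longleftrightarrow> (\<forall>A\<subseteq>I. long_legs g (word (lower A H)))"

text \<open>Normal form of a cube: the given representative is replaced by the highest member, and
  its heights are translated to vanish at \<open>0\<close>.\<close>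

lemma TF_cases:
  assumes "F \<in> TF m n g"
  obtains H I where "path H" "H 0 = 0" "I \<subseteq> peaks H" "all_long g H I" "F = cube H I"
proof -
  from assms obtain s I where F: "F = (I, flip_members m n s I)"
    and s: "torus_front m n s" and pos: "flip_positions m n s I"
    and long: "\<forall>t \<in> flip_members m n s I. long_legs g t"
    by (auto simp: TF_def)
  define K where "K = height s"
  have K: "path K" "word K = s" using path_height[OF s] by (simp_all add: K_def)
  \<comment> \<open>A descent into a flip position marks the low corner \<open>EN\<close>; raising
    it by \<open>L\<close> gives the high corner \<open>NE\<close>.\<close>
  define H where "H k = K k + (if k mod L \<in> I \<and> K k = K (k - 1) - int m then L else 0)" for k
  have I_mod: "i mod L = i" if "i \<in> I" for i
    using that pos by (auto simp: flip_positions_def)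
  have not_adj: "\<not> (k mod L \<in> I \<and> (k - 1) mod L \<in> I)" for k
  proof
    assume a: "k mod L \<in> I \<and> (k - 1) mod L \<in> I"
    have "(k mod L - (k - 1) mod L) mod L = 1" using L_ge_2 by (simp add: mod_diff_eq)
    moreover from this have "k mod L \<noteq> (k - 1) mod L" by auto
    then have "2 \<le> (k mod L - (k - 1) mod L) mod L"
      using a pos by (auto simp: flip_positions_def cyclic_dist_def)
    ultimately show False by simp
  qed
  have corner: "K k = K (k - 1) - int m \<longleftrightarrow> K (k + 1) = K k + int n" if "k mod L \<in> I" for k
  proof -
    have "s (k mod L) \<noteq> s (k mod L + 1)" using that pos by (auto simp: flip_positions_def)
    moreover have "s (k mod L) = s k" "s ((k mod L + 1) mod L) = s (k mod L + 1)"
      "s ((k + 1) mod L) = s (k + 1)"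
      using s by (auto intro!: periodic_mod simp: torus_front_def)
    ultimately have "s k \<noteq> s (k + 1)" by (simp add: mod_add_left_eq)
    then show ?thesis
      using path_step[OF K(1), of k] path_step[OF K(1), of "k + 1"] L_pos
      unfolding K(2)[symmetric] by (auto simp: word_def split: if_splits)
  qed
  have H: "path H" unfolding path_def
  proof (intro conjI allI)
    fix k
    show "H (k + L) = H k"
      using path_add_L[OF K(1), of k 0] path_add_L[OF K(1), of k 1] by (simp add: H_def)
    show "H k = H (k - 1) + int n \<or> H k = H (k - 1) - int m"
      using path_step[OF K(1), of k] not_adj[of k] corner[of k] corner[of "k - 1"]
      by (auto simp: H_def)
  qed
  have I: "I \<subseteq> peaks H"
  proof
    fix i assume i: "i \<in> I"
    then have "i mod L \<in> I" "(i - 1) mod L \<notin> I" "(i + 1) mod L \<notin> I" "i \<in> {0..<L}"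
      using I_mod[OF i] not_adj[of i] not_adj[of "i + 1"] pos by (auto simp: flip_positions_def)
    then show "i \<in> peaks H"
      using path_step[OF K(1), of i] path_step[OF K(1), of "i + 1"] corner[of i]
      by (auto simp: H_def peaks_def)
  qed
  have cube: "F = cube H I" unfolding F
  proof (rule flip_members_eq[OF H I])
    fix j assume "j mod L \<notin> I" "(j - 1) mod L \<notin> I"
    then show "s j = word H j" unfolding K(2)[symmetric] by (simp add: word_def H_def)
  qed
  let ?H = "\<lambda>k. H k + (- H 0)"
  show thesis
  proof (rule that[of ?H I])
    show "path ?H" by (rule path_shift[OF H])
    show "I \<subseteq> peaks ?H" unfolding peaks_shift by (rule I)
    show "F = cube ?H I" unfolding cube_shift by (rule cube)
    show "all_long g ?H I"
      unfolding all_long_def lower_shift word_shift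
      using long cube F by (auto simp: cube_def)
  qed simp
qed

lemma cube_in_TF:
  assumes "path H" "I \<subseteq> peaks H" "all_long g H I"
  shows "cube H I \<in> TF m n g"
proof -
  have eq: "(I, flip_members m n (word H) I) = cube H I"
    by (rule flip_members_eq[OF assms(1,2)]) simp
  then have "\<forall>t \<in> flip_members m n (word H) I. long_legs g t"
    using assms(3) by (auto simp: cube_def all_long_def)
  then show ?thesis
    unfolding TF_def eq[symmetric]
    using torus_front_word[OF assms(1)] flip_positions_peaks[OF assms(1,2)] by blast
qed

lemma finite_peaks: "finite (peaks H)"
  by (rule finite_subset[of _ "{0..<L}"]) (auto simp: peaks_def)

text \<open>The top \<open>H\<close> of the smaller cube is a member of the larger one, hence
  \<open>K\<close> lowered at some \<open>A\<close>, up to a constant. At positions in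
  \<open>I\<close> the word of \<open>H\<close> goes north first, so \<open>A\<close> avoids
  \<open>I\<close>.\<close>

lemma cube_subD:
  assumes H: "path H" "I \<subseteq> peaks H" and K: "path K" "J \<subseteq> peaks K"
    and sub: "I \<subseteq> J" "snd (cube H I) \<subseteq> snd (cube K J)"
  obtains A where "A \<subseteq> J - I" "H = (\<lambda>k. lower A K k + (H 0 - lower A K 0))"
proof -
  have "word (lower {} H) \<in> snd (cube H I)" unfolding cube_def snd_conv by (rule imageI) simp
  with sub(2) have "word H \<in> snd (cube K J)" by auto
  then obtain A where A: "A \<subseteq> J" "word H = word (lower A K)" by (auto simp: cube_def)
  have "i \<notin> A" if "i \<in> I" for i
  proof -
    have "i mod L = i" "word H i = North" using that H(2) by (auto simp: peaks_def word_def)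
    then show ?thesis
      using word_lower_at(1)[OF K A(1), of i] A(2) that sub(1) by auto
  qed
  with A(1) have "A \<subseteq> J - I" by auto
  moreover have "H = (\<lambda>k. lower A K k + (H 0 - lower A K 0))"
    using word_eqD[OF H(1) _ A(2)] path_lower[OF K(1)] A(1) K(2) by blast
  ultimately show thesis by (rule that)
qed

text \<open>For \<open>I = J\<close> the set \<open>A\<close> of \<open>cube_subD\<close> is empty,
  and the normalisation removes the constant. This makes matched pairs disjoint.\<close>

lemma cube_inj:
  assumes "path H" "I \<subseteq> peaks H" "H 0 = 0" and "path K" "J \<subseteq> peaks K" "K 0 = 0"
    and "cube H I = cube K J"
  shows "H = K \<and> I = J"
proof -
  from assms(7) have IJ: "I = J" by (simp add: cube_def)
  obtain A where "A \<subseteq> J - I" "H = (\<lambda>k. lower A K k + (H 0 - lower A K 0))"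
    using cube_subD[OF assms(1,2,4,5)] IJ assms(7) by auto
  with IJ assms(3,6) show ?thesis by auto
qed

text \<open>The face keeps the corner at \<open>p\<close> in its high position, so
  \<open>North\<close> is the orientation to fix there.\<close>

lemma cube_face_insert:
  assumes "path H" "insert p I \<subseteq> peaks H" "p \<notin> I"
  shows "flip_face (cube H I) (cube H (insert p I))"
proof -
  have p: "p mod L = p" using assms(2) by (auto simp: peaks_def)
  have at: "word (lower A H) p = North \<longleftrightarrow> p \<notin> A" if "A \<subseteq> insert p I" for A
    using word_lower_at(1)[OF assms(1,2) that, of p] p by simp
  have "snd (cube H I) = {t \<in> snd (cube H (insert p I)). \<forall>i \<in> insert p I - I. t i = North}"
    using at assms(3) by (auto simp: cube_def insert_Diff_if)
  then show ?thesis unfolding flip_face_def by (auto simp: cube_def)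
qed

subsection \<open>Fat cubes\<close>

text \<open>Since \<open>H\<close> is the top of the cube and \<open>lower I H\<close> its bottom, this is the negation of
  thinness.\<close>

definition fat :: "(int \<Rightarrow> int) \<Rightarrow> int set \<Rightarrow> bool" where
  "fat H I \<longleftrightarrow> (\<exists>k l. H k - lower I H l > L)"

text \<open>The high point is read off the top and the low point off the bottom, but one member
  attains both: lower only at \<open>l\<close>. This leaves \<open>k\<close> alone, since at equal
  residues the difference would be at most \<open>L\<close>.\<close>

lemma fat_member:
  assumes "path H" "fat H I"
  obtains A k l where "A \<subseteq> I" "lower A H k - lower A H l > L"
proof -
  from assms obtain k l where kl: "H k - lower I H l > L" by (auto simp: fat_def)
  have "k mod L \<noteq> l mod L"
  proof
    assume "k mod L = l mod L"
    then have "H k = H l" by (rule path_cong[OF assms(1)])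
    then show False using kl by (auto simp: lower_def split: if_splits)
  qed
  then have "lower (I \<inter> {l mod L}) H k = H k" "lower (I \<inter> {l mod L}) H l = lower I H l"
    by (auto simp: lower_def)
  with kl show thesis by (intro that[of "I \<inter> {l mod L}" k l]) auto
qed

text \<open>A fat cube has a wide member by \<open>fat_member\<close>; conversely all members lie
  between \<open>lower I H\<close> and \<open>H\<close>.\<close>

lemma thin_cube_iff:
  assumes "path H" "I \<subseteq> peaks H"
  shows "thin_flip m n (cube H I) \<longleftrightarrow> \<not> fat H I"
proof -
  have fin: "finite I" using assms(2) finite_peaks finite_subset by blast
  have "thin_flip m n (cube H I) \<longleftrightarrow> (\<forall>A\<subseteq>I. front_width m n (word (lower A H)) \<le> sqrt 2)"
    unfolding thin_flip_def flip_width_def cube_def snd_conv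
    using fin by (subst Max_le_iff) auto
  also have "\<dots> \<longleftrightarrow> (\<forall>A\<subseteq>I. \<forall>k l. lower A H k - lower A H l \<le> L)"
    using front_width_le_iff path_lower[OF assms(1)] assms(2) by (meson subset_trans)
  also have "\<dots> \<longleftrightarrow> \<not> fat H I"
  proof
    assume "\<forall>A\<subseteq>I. \<forall>k l. lower A H k - lower A H l \<le> L"
    then show "\<not> fat H I" using fat_member[OF assms(1)] by (metis not_less)
  next
    assume *: "\<not> fat H I"
    show "\<forall>A\<subseteq>I. \<forall>k l. lower A H k - lower A H l \<le> L"
    proof (intro allI impI)
      fix A k l assume "A \<subseteq> I"
      then have "lower I H l \<le> lower A H l" by (rule lower_antimono)
      moreover have "H k - lower I H l \<le> L" using * by (auto simp: fat_def not_less)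
      ultimately show "lower A H k - lower A H l \<le> L" using lower_le[of A H k] by simp
    qed
  qed
  finally show ?thesis .
qed

lemma fat_mono:
  assumes "fat H I" "I \<subseteq> J"
  shows "fat H J"
proof -
  from assms(1) obtain k l where "H k - lower I H l > L" by (auto simp: fat_def)
  moreover have "lower J H l \<le> lower I H l" by (rule lower_antimono[OF assms(2)])
  ultimately have "H k - lower J H l > L" by simp
  then show ?thesis unfolding fat_def by blast
qed

lemma max_peak:
  assumes "path H" "p \<in> {0..<L}" "\<And>k. H k \<le> H p"
  shows "p \<in> peaks H"
  using path_step[OF assms(1), of p] path_step[OF assms(1), of "p + 1"]
    assms(3)[of "p - 1"] assms(3)[of "p + 1"] assms(2) m_pos n_pos
  by (auto simp: peaks_def)

text \<open>Fatness puts the lowest point more than \<open>L\<close> below \<open>H p\<close>. So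
  position \<open>p\<close>, lowered or not, stays strictly above it and affects neither the minimum
  nor fatness.\<close>

lemma fat_insert_max:
  assumes H: "path H" and p: "p \<in> {0..<L}" and max: "\<And>k. H k \<le> H p"
    and fat: "fat H (insert p I)"
  shows "fat H I"
    and "p \<notin> I \<Longrightarrow> Min (range (lower (insert p I) H)) = Min (range (lower I H))"
proof -
  from fat obtain k l where kl: "H k - lower (insert p I) H l > L" by (auto simp: fat_def)
  have top: "H x = H p" if "x mod L = p" for x using path_mod[OF H, of x] that by simp
  have "l mod L \<noteq> p"
    using kl max[of k] top[of l] by (auto simp: lower_def split: if_splits)
  then have l: "lower I H l = lower (insert p I) H l" by (simp add: lower_def)
  with kl show "fat H I" unfolding fat_def by metis
  assume "p \<notin> I"
  have "finite (range (lower J H))" for J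
  proof (rule finite_subset)
    show "range (lower J H) \<subseteq> range H \<union> (\<lambda>x. x - L) ` range H" by (auto simp: lower_def)
  qed (use finite_range_path[OF H] in auto)
  note fin = this
  let ?M = "Min (range (lower I H))"
  have le: "?M \<le> lower I H x" for x using fin by simp
  show "Min (range (lower (insert p I) H)) = ?M"
  proof (rule Min_eqI[OF fin])
    fix y assume "y \<in> range (lower (insert p I) H)"
    then obtain x where x: "y = lower (insert p I) H x" by blast
    show "?M \<le> y"
    proof (cases "x mod L = p")
      case True
      then have "y = H p - L" using x top by (simp add: lower_def)
      then show ?thesis using kl max[of k] l le[of l] by simp
    next
      case False
      then show ?thesis using x le[of x] by (simp add: lower_def)
    qed
  next
    obtain x where x: "?M = lower I H x"
      using Min_in[OF fin[of I]] by auto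
    have "x mod L \<noteq> p"
    proof
      assume "x mod L = p"
      then have "?M = H p" using x top[of x] \<open>p \<notin> I\<close> by (simp add: lower_def)
      then show False using le[of l] l kl max[of k] L_pos by simp
    qed
    then have "?M = lower (insert p I) H x" using x by (simp add: lower_def)
    then show "?M \<in> range (lower (insert p I) H)" by simp
  qed
qed

section \<open>Leg lengths when a maximum is lowered\<close>

text \<open>At most one of \<open>g\<close> consecutive steps goes north, and it changes the total
  descent by \<open>n + m = L\<close>. The witness \<open>r\<close> records that this step has
  occurred, which rules out a second one in the induction.\<close>

lemma long_legs_climb:
  assumes K: "path K" and long: "long_legs g (word K)"
  shows "d \<le> g \<Longrightarrow> K (x + int d) = K x - int m * int d \<or>
    K (x + int d) = K x + L - int m * int d \<and> (\<exists>r. x < r \<and> r \<le> x + int d \<and> word K r = North)"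
proof (induction d)
  case (Suc d)
  let ?y = "x + int (Suc d)"
  have y: "K ?y = K (x + int d) + (if word K ?y = North then int n else - int m)"
    using path_step_word[OF K, of ?y] by simp
  have no: False if "word K ?y = North" "x < r" "r \<le> x + int d" "word K r = North" for r
  proof -
    have "int g \<le> ?y - r" using long that unfolding long_legs_iff by force
    then show False using that Suc.prems by simp
  qed
  show ?case
  proof (cases "word K ?y = North")
    case True
    with no Suc have "K (x + int d) = K x - int m * int d" by auto
    then have "K ?y = K x + L - int m * int (Suc d)" using y True by (simp add: algebra_simps)
    with True show ?thesis by (intro disjI2 conjI exI[of _ ?y]) auto
  next
    case False
    have "K (x + int d) = K x - int m * int d \<or>
      K (x + int d) = K x + L - int m * int d \<and> (\<exists>r. x < r \<and> r \<le> x + int d \<and> word K r = North)"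
      using Suc by simp
    then show ?thesis
    proof
      assume "K (x + int d) = K x - int m * int d"
      then show ?thesis using y False by (simp add: algebra_simps)
    next
      assume *: "K (x + int d) = K x + L - int m * int d \<and> (\<exists>r. x < r \<and> r \<le> x + int d \<and> word K r = North)"
      then have "K ?y = K x + L - int m * int (Suc d)" using y False by (simp add: algebra_simps)
      moreover from * have "\<exists>r. x < r \<and> r \<le> ?y \<and> word K r = North" by force
      ultimately show ?thesis by blast
    qed
  qed
qed simp

text \<open>Here every \<open>g\<close> consecutive steps go down weakly, hence by periodicity keep the height, so that
  all legs have length exactly \<open>g\<close>.\<close>

lemma thin_of_tight:
  assumes K: "path K" and long: "long_legs g (word K)" and "g > 0"
    and tight: "int n \<le> int m * (int g - 1)"
  shows "K k - K l \<le> L"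
proof -
  \<comment> \<open>Even with a northbound step, the change over \<open>g\<close> steps is
    \<open>L - m * g = n - m * (g - 1)\<close>, which is at most \<open>0\<close> by
    \<open>tight\<close>.\<close>
  have desc: "K (x + int g) \<le> K x" for x
    using long_legs_climb[OF K long, of g x] tight L_pos \<open>g > 0\<close>
    by (auto simp: algebra_simps)
  have desc': "K (x + int g * int j) \<le> K x" for x j
  proof (induction j)
    case (Suc j)
    then show ?case using desc[of "x + int g * int j"] by (simp add: algebra_simps)
  qed simp
  have per: "K (x + int g) = K x" for x
  proof (rule antisym[OF desc])
    \<comment> \<open>In all, \<open>L\<close> shifts by \<open>g\<close> move by a multiple of the
      period. One shift is already made, which leaves \<open>m + n - 1\<close>.\<close>
    have "K ((x + int g) + int g * int (m + n - 1)) = K x"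
    proof (rule path_cong[OF K])
      have "x + int g + int g * int (m + n - 1) = x + int g * L"
        using m_pos by (simp add: of_nat_diff algebra_simps)
      then show "(x + int g + int g * int (m + n - 1)) mod L = x mod L"
        by (simp only: mod_mult_self1)
    qed
    with desc'[of "x + int g" "m + n - 1"] show "K x \<le> K (x + int g)" by simp
  qed
  \<comment> \<open>As \<open>K\<close> has period \<open>g\<close>, the position \<open>k\<close>
    may be replaced by one fewer than \<open>g\<close> steps after \<open>l\<close>, within reach of
    \<open>long_legs_climb\<close>.\<close>
  define d where "d = nat ((k - l) mod int g)"
  have d: "int d = (k - l) mod int g" using \<open>g > 0\<close> by (simp add: d_def)
  have d_le: "d \<le> g"
    unfolding d_def nat_le_iff using \<open>g > 0\<close> by (intro less_imp_le pos_mod_bound) simp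
  have "K k = K (l + int d)"
  proof -
    have "K (l + int d) = K ((l + int d) mod int g)" by (rule periodic_mod[symmetric], rule per)
    also have "(l + int d) mod int g = k mod int g" unfolding d by (simp add: mod_add_right_eq)
    also have "K (k mod int g) = K k" by (rule periodic_mod, rule per)
    finally show ?thesis by simp
  qed
  moreover have "0 \<le> int m * int d" by simp
  ultimately show ?thesis using long_legs_climb[OF K long d_le, of l] L_pos by linarith
qed

text \<open>Lowering at \<open>p\<close> delays the northbound step \<open>p\<close> by one, so only
  the leg that starts with it can become shorter.\<close>

lemma all_long_insert_max:
  assumes H: "path H" "I \<subseteq> peaks H" and long: "all_long g H I" and fat: "fat H I" and "g > 0"
    and p: "p \<in> {0..<L}" and max: "\<And>k. H k \<le> H p"
  shows "all_long g H (insert p I)"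
  unfolding all_long_def
proof (intro allI impI)
  have loose: "int m * (int g - 1) < int n"
  proof -
    obtain A k l where A: "A \<subseteq> I" "lower A H k - lower A H l > L"
      by (rule fat_member[OF H(1) fat])
    have "path (lower A H)" using path_lower H A by blast
    moreover have "long_legs g (word (lower A H))" using long A by (simp add: all_long_def)
    ultimately show ?thesis
      using thin_of_tight[of "lower A H" g k l] A(2) \<open>g > 0\<close> by linarith
  qed
  fix A assume A: "A \<subseteq> insert p I"
  show "long_legs g (word (lower A H))"
  proof (cases "p \<in> A")
    case False
    then show ?thesis using A long by (auto simp: all_long_def)
  next
    case True
    \<comment> \<open>The member that agrees with the desired one except that \<open>p\<close> is
      still high; it belongs to the original cube.\<close>
    define K where "K = lower (A - {p}) H"
    have "A - {p} \<subseteq> I" using A by blast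
    then have K: "path K" "long_legs g (word K)"
      using path_lower H long by (auto simp: K_def all_long_def)
    have A_eq: "lower A H = lower {p} K"
      unfolding K_def using True by (subst lower_lower) (auto simp: insert_absorb)
    have Kp: "K P = H p" if "P mod L = p" for P
      using path_mod[OF H(1), of P] that by (simp add: K_def lower_def)
    have Kmax: "K k \<le> H p" for k
      using lower_le[of "A - {p}" H k] max[of k] by (simp add: K_def)
    have "p mod L = p" using p by simp
    then have peak: "{p} \<subseteq> peaks K"
      using max_peak[OF K(1) p] Kmax Kp[of p] by simp
    note at = word_lower_at[OF K(1) peak subset_refl]
    have north: "word K k = North" if "k mod L = p" for k
      using peak_modD(1)[OF K(1), of k] peak that by (simp add: word_def)
    have gap: "int g \<le> j - i" if "i < j" "word K i = North" "word K j = North" for i j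
      using K(2) that unfolding long_legs_iff by blast
    \<comment> \<open>If the leg after the summit had only \<open>g\<close> vertices, the northbound
      step ending it would reach \<open>H p - m * (g - 1) + n\<close>, above the maximum by
      \<open>loose\<close>.\<close>
    have wide_gap: "int g + 1 \<le> j - i"
      if ij: "i < j" and i: "i mod L = p" and j: "word K j = North" for i j
    proof (rule ccontr)
      assume "\<not> ?thesis"
      then have j_eq: "j = i + int g" using gap[OF ij north[OF i] j] by simp
      have Kj: "K j = K (i + int (g - 1)) + int n"
        using path_step_word[OF K(1), of j] j j_eq \<open>g > 0\<close> by (simp add: of_nat_diff algebra_simps)
      have "\<not> (i < r \<and> r \<le> i + int (g - 1) \<and> word K r = North)" for r
        using gap[of r j] j j_eq \<open>g > 0\<close> by (auto simp: of_nat_diff)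
      then have "K (i + int (g - 1)) = K i - int m * int (g - 1)"
        using long_legs_climb[OF K, of "g - 1" i] by auto
      then have "K j = H p - int m * (int g - 1) + int n"
        using Kj Kp[OF i] \<open>g > 0\<close> by (simp add: of_nat_diff)
      then show False using Kmax[of j] loose by simp
    qed
    show ?thesis unfolding A_eq long_legs_iff
    proof (intro allI impI, elim conjE)
      fix i j :: int
      assume ij: "i < j" "word (lower {p} K) i = North" "word (lower {p} K) j = North"
      have north_lower: "k mod L \<noteq> p" "(k - 1) mod L = p \<or> word K k = North"
        if "word (lower {p} K) k = North" for k
      proof -
        show "k mod L \<noteq> p" using at(1)[of k] that by auto
        then show "(k - 1) mod L = p \<or> word K k = North"
          using at(3)[of k] that by (cases "(k - 1) mod L = p") simp_all
      qed
      \<comment> \<open>The cases say which of the two northbound steps was delayed from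
        \<open>p\<close> to \<open>p + 1\<close>. The distance shrinks only if just the first was,
        and then \<open>wide_gap\<close> supplies the spare unit.\<close>
      show "int g \<le> j - i"
      proof (cases "(j - 1) mod L = p")
        case True
        then have "i \<noteq> j - 1" using north_lower(1)[OF ij(2)] by auto
        then have "i < j - 1" using ij(1) by simp
        show ?thesis
        proof (cases "(i - 1) mod L = p")
          case True
          show ?thesis using gap[of "i - 1" "j - 1"] north[OF True] north[OF \<open>(j - 1) mod L = p\<close>] ij(1)
            by simp
        next
          case False
          then show ?thesis
            using gap[of i "j - 1"] north[OF True] north_lower(2)[OF ij(2)] \<open>i < j - 1\<close> by simp
        qed
      next
        case False
        then have j: "word K j = North" using north_lower(2)[OF ij(3)] by blast
        show ?thesis
        proof (cases "(i - 1) mod L = p")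
          case True
          then show ?thesis using wide_gap[OF _ True j] ij(1) by simp
        next
          case False
          then show ?thesis using gap[OF ij(1) _ j] north_lower(2)[OF ij(2)] by blast
        qed
      qed
    qed
  qed
qed

section \<open>Volume and fatness under passage to faces\<close>

text \<open>Measuring from the lowest point makes this invariant under adding a constant to
  \<open>H\<close>, hence an invariant of the cube.\<close>

definition volume :: "(int \<Rightarrow> int) \<Rightarrow> int set \<Rightarrow> int" where
  "volume H I = sum H {0..<L} - L * Min (range (lower I H))"

text \<open>Each lowered position in \<open>A\<close> costs the top path \<open>L\<close>. The
  bottom of the face is \<open>K\<close> lowered at a subset of \<open>J\<close>, so its minimum is
  no lower than that of the coface, up to the shift \<open>c\<close>.\<close>

lemma volume_face:
  assumes K: "path K" "J \<subseteq> peaks K" and A: "A \<subseteq> J - I" and "I \<subseteq> J"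
    and H: "H = (\<lambda>k. lower A K k + c)"
  shows "volume H I + L * int (card A) \<le> volume K J"
proof -
  have A': "A \<subseteq> {0..<L}" using A K(2) by (auto simp: peaks_def)
  have "sum (lower A K) {0..<L} = sum K {0..<L} - (\<Sum>k\<in>{0..<L}. if k \<in> A then L else 0)"
    by (simp add: lower_def sum_subtractf)
  also have "(\<Sum>k\<in>{0..<L}. if k \<in> A then L else 0) = (\<Sum>k\<in>A. L)"
    using A' by (simp add: sum.If_cases inf.absorb2)
  finally have sum: "sum H {0..<L} = sum K {0..<L} - L * int (card A) + L * c"
    unfolding H by (simp add: sum.distrib)
  have low: "lower I H = (\<lambda>k. lower (I \<union> A) K k + c)"
    unfolding H lower_shift using A by (subst lower_lower) auto
  have sub: "I \<union> A \<subseteq> peaks K" using A K(2) \<open>I \<subseteq> J\<close> by blast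
  have fin: "finite (range (lower I H))" unfolding low
    by (intro finite_range_path path_shift path_lower K(1) sub)
  have "Min (range (lower I H)) \<in> range (lower I H)" using fin by (intro Min_in) auto
  then obtain x where x: "Min (range (lower I H)) = lower I H x" by auto
  have "Min (range (lower J K)) \<le> lower J K x"
    using finite_range_path[OF path_lower[OF K]] by simp
  also have "\<dots> \<le> lower (I \<union> A) K x" using A \<open>I \<subseteq> J\<close> by (intro lower_antimono) auto
  finally have "Min (range (lower J K)) + c \<le> Min (range (lower I H))" unfolding x unfolding low by simp
  then have "L * (Min (range (lower J K)) + c) \<le> L * Min (range (lower I H))"
    using L_pos by (intro mult_left_mono) auto
  then show ?thesis unfolding volume_def sum by (simp add: algebra_simps)
qed

text \<open>Up to \<open>c\<close>, the face lies between the top and the bottom of its coface. In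
  contrapositive form, thin flips are closed under faces.\<close>

lemma fat_face:
  assumes "A \<subseteq> J - I" "I \<subseteq> J" and H: "H = (\<lambda>k. lower A K k + c)" and "fat H I"
  shows "fat K J"
proof -
  from assms(4) obtain k l where kl: "H k - lower I H l > L" by (auto simp: fat_def)
  have "lower I H l = lower (I \<union> A) K l + c"
    unfolding H lower_shift using assms(1) by (subst lower_lower) auto
  moreover have "lower J K l \<le> lower (I \<union> A) K l" using assms(1,2) by (intro lower_antimono) auto
  moreover have "H k \<le> K k + c" unfolding H using lower_le by simp
  ultimately have "K k - lower J K l > L" using kl by simp
  then show ?thesis unfolding fat_def by blast
qed

section \<open>The matching of fat flips and the collapse\<close>

text \<open>The choice ignores \<open>I\<close>, so the two cubes of a matched pair, which share
  \<open>H\<close>, select the same position.\<close>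

definition summit :: "(int \<Rightarrow> int) \<Rightarrow> int" where
  "summit H = (SOME p. p \<in> {0..<L} \<and> (\<forall>k. H k \<le> H p))"

lemma summit:
  assumes "path H"
  shows "summit H \<in> {0..<L}" "H k \<le> H (summit H)"
proof -
  have fin: "finite (range H)" by (rule finite_range_path[OF assms])
  then have "Max (range H) \<in> range H" by (intro Max_in) auto
  then obtain x where x: "Max (range H) = H x" by auto
  have "x mod L \<in> {0..<L} \<and> (\<forall>k. H k \<le> H (x mod L))"
    unfolding path_mod[OF assms] x[symmetric] using fin L_pos by simp
  then have "summit H \<in> {0..<L} \<and> (\<forall>k. H k \<le> H (summit H))"
    unfolding summit_def by (rule someI)
  then show "summit H \<in> {0..<L}" "H k \<le> H (summit H)" by auto
qed

lemma collapses_to_thin: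
  assumes "g > 0"
  shows "collapses_to (TF m n g) {F \<in> TF m n g. thin_flip m n F}"
proof -
  let ?Y = "{F \<in> TF m n g. thin_flip m n F}"
  \<comment> \<open>Each pair is indexed by its smaller cube; the normalisation
    \<open>H 0 = 0\<close> makes the index unique and \<open>Q\<close> finite.\<close>
  define Q where "Q = {(H, I). path H \<and> H 0 = 0 \<and> I \<subseteq> peaks H \<and> all_long g H I \<and> fat H I
    \<and> summit H \<notin> I}"
  let ?F = "\<lambda>(H, I). cube H I"
  let ?G = "\<lambda>(H, I). cube H (insert (summit H) I)"
  let ?r = "\<lambda>(H, I). volume H I + int (card I)"
  have Q: "path H" "H 0 = 0" "I \<subseteq> peaks H" "insert (summit H) I \<subseteq> peaks H" "all_long g H I"
    "fat H I" "summit H \<notin> I" "finite I"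
    if "(H, I) \<in> Q" for H I
  proof -
    show H: "path H" and I: "I \<subseteq> peaks H" and "H 0 = 0" "all_long g H I" "fat H I" "summit H \<notin> I"
      using that by (auto simp: Q_def)
    show "insert (summit H) I \<subseteq> peaks H"
      using max_peak[OF H summit(1)[OF H]] summit(2)[OF H] I by blast
    show "finite I" by (rule finite_subset[OF I finite_peaks])
  qed
  have "finite Q"
  proof (rule finite_subset)
    show "Q \<subseteq> (height ` {s. torus_front m n s}) \<times> Pow {0..<L}"
    proof (rule subrelI)
      fix H I assume HI: "(H, I) \<in> Q"
      have "H = height (word H)" using height_word[OF Q(1)[OF HI]] Q(2)[OF HI] by auto
      moreover have "torus_front m n (word H)" by (rule torus_front_word[OF Q(1)[OF HI]])
      moreover have "I \<subseteq> {0..<L}" using Q(3)[OF HI] by (auto simp: peaks_def)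
      ultimately show "(H, I) \<in> (height ` {s. torus_front m n s}) \<times> Pow {0..<L}" by blast
    qed
  qed (simp add: finite_fronts)
  have long_J: "all_long g H (insert (summit H) I)" if "(H, I) \<in> Q" for H I
    by (rule all_long_insert_max[OF Q(1,3,5,6)[OF that] \<open>g > 0\<close>]) (rule summit[OF Q(1)[OF that]])+
  have fat_J: "fat H (insert (summit H) I)" if "(H, I) \<in> Q" for H I
    using fat_mono[OF Q(6)[OF that]] by blast
  have volume_J: "volume H (insert (summit H) I) = volume H I" if "(H, I) \<in> Q" for H I
  proof -
    have "Min (range (lower (insert (summit H) I) H)) = Min (range (lower I H))"
      by (rule fat_insert_max(2)[OF Q(1)[OF that] _ _ fat_J[OF that] Q(7)[OF that]])
        (rule summit[OF Q(1)[OF that]])+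
    then show ?thesis by (simp add: volume_def)
  qed
  have face: "I \<subseteq> J \<and> (\<exists>A\<subseteq>J - I. H = (\<lambda>k. lower A K k + (H 0 - lower A K 0)))"
    if f: "flip_face (cube H I) (cube K J)" and paths: "path H" "I \<subseteq> peaks H" "path K" "J \<subseteq> peaks K" for H I K J
  proof -
    have sub: "I \<subseteq> J" "snd (cube H I) \<subseteq> snd (cube K J)"
      using f unfolding flip_face_def by (auto simp: cube_def)
    obtain A where "A \<subseteq> J - I" "H = (\<lambda>k. lower A K k + (H 0 - lower A K 0))"
      by (rule cube_subD[OF paths sub])
    with sub(1) show ?thesis by blast
  qed
  have "TF m n g = ?Y \<union> ?F ` Q \<union> ?G ` Q"
  proof
    show "TF m n g \<subseteq> ?Y \<union> ?F ` Q \<union> ?G ` Q"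
    proof
      fix F assume F: "F \<in> TF m n g"
      then obtain H I where H: "path H" "H 0 = 0" "I \<subseteq> peaks H" "all_long g H I" "F = cube H I"
        by (rule TF_cases)
      show "F \<in> ?Y \<union> ?F ` Q \<union> ?G ` Q"
      proof (cases "fat H I")
        case False
        then show ?thesis using F H thin_cube_iff by auto
      next
        case True
        show ?thesis
        proof (cases "summit H \<in> I")
          case False
          then have "(H, I) \<in> Q" using H True by (simp add: Q_def)
          then show ?thesis using H(5) by force
        next
          \<comment> \<open>This cube is the larger one of its pair; deleting the summit keeps it
            fat by \<open>fat_insert_max\<close>.\<close>
          case in_I: True
          then have I: "insert (summit H) (I - {summit H}) = I" by blast
          have "fat H (insert (summit H) (I - {summit H}))" using True I by simp
          then have "fat H (I - {summit H})"
            by (rule fat_insert_max(1)[OF H(1) summit[OF H(1)]])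
          moreover have "all_long g H (I - {summit H})" using H(4) by (auto simp: all_long_def)
          ultimately have "(H, I - {summit H}) \<in> Q" using H by (auto simp: Q_def)
          moreover have "F = ?G (H, I - {summit H})" using H(5) I by simp
          ultimately show ?thesis by blast
        qed
      qed
    qed
    show "?Y \<union> ?F ` Q \<union> ?G ` Q \<subseteq> TF m n g"
      using cube_in_TF Q long_J by auto
  qed
  moreover have "collapses_to (?Y \<union> ?F ` Q \<union> ?G ` Q) ?Y"
  proof (rule collapses_to_by_matching[where r = ?r])
    show "finite Q" by fact
  next
    fix q assume "q \<in> Q"
    then obtain H I where q: "q = (H, I)" "(H, I) \<in> Q" by (cases q) auto
    note q' = Q[OF q(2)]
    show "?F q \<noteq> ?G q \<and> flip_face (?F q) (?G q) \<and> flip_dim (?G q) = flip_dim (?F q) + 1"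
      using cube_face_insert[OF q'(1,4,7)] q'(7,8) unfolding q(1)
      by (auto simp: flip_dim_def cube_def)
    show "?F q \<notin> ?Y \<and> ?G q \<notin> ?Y"
      using thin_cube_iff[OF q'(1,3)] thin_cube_iff[OF q'(1,4)] q'(6) fat_J[OF q(2)] q(1) by simp
    fix C assume C: "C \<in> ?Y"
    then obtain K J where K: "path K" "J \<subseteq> peaks K" "C = cube K J"
      using TF_cases by (metis (no_types, lifting) mem_Collect_eq)
    show "\<not> flip_face (?F q) C"
    proof
      assume "flip_face (?F q) C"
      then have "flip_face (cube H I) (cube K J)" using q K by simp
      from face[OF this q'(1,3) K(1,2)] fat_face q'(6) have "fat K J" by blast
      then show False using C K thin_cube_iff by simp
    qed
  next
    fix q q' assume "q \<in> Q" "q' \<in> Q" "q \<noteq> q'"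
    then obtain H I K J where q: "q = (H, I)" "q' = (K, J)" "(H, I) \<in> Q" "(K, J) \<in> Q" "(H, I) \<noteq> (K, J)"
      by (cases q, cases q') auto
    note H = Q[OF q(3)] and K = Q[OF q(4)]
    have inj: "H = K \<and> I' = J'" if "cube H I' = cube K J'" "I' \<subseteq> peaks H" "J' \<subseteq> peaks K" for I' J'
      using cube_inj[OF H(1) that(2) H(2) K(1) that(3) K(2) that(1)] .
    show "{?F q, ?G q} \<inter> {?F q', ?G q'} = {}"
    proof -
      have "cube H I \<noteq> cube K J"
        using inj[OF _ H(3) K(3)] q(5) by blast
      moreover have "cube H I \<noteq> cube K (insert (summit K) J)"
        using inj[OF _ H(3) K(4)] H(7) by blast
      moreover have "cube H (insert (summit H) I) \<noteq> cube K J"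
        using inj[OF _ H(4) K(3)] K(7) by blast
      moreover have "cube H (insert (summit H) I) \<noteq> cube K (insert (summit K) J)"
        using inj[OF _ H(4) K(4)] H(7) K(7) q(5) insert_ident by metis
      ultimately show ?thesis unfolding q by simp
    qed
  next
    fix q q' C assume a: "q \<in> Q" "q' \<in> Q" "C \<in> {?F q', ?G q'}" "flip_face (?F q) C" "q \<noteq> q'"
    then obtain H I K J where q: "q = (H, I)" "q' = (K, J)" "(H, I) \<in> Q" "(K, J) \<in> Q" "(H, I) \<noteq> (K, J)"
      by (cases q, cases q') auto
    note H = Q[OF q(3)] and K = Q[OF q(4)]
    obtain J' where J': "C = cube K J'" "J' = J \<or> J' = insert (summit K) J"
      using a(3) q(2) by auto
    then have J'_peaks: "J' \<subseteq> peaks K" and J'_volume: "volume K J' = volume K J"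
      using K(3,4) volume_J[OF q(4)] by auto
    have J'_fin: "finite J'" and J'_card: "card J' \<le> card J + 1"
      using J'(2) K(8) by (auto simp: card_insert_if)
    obtain A where A: "I \<subseteq> J'" "A \<subseteq> J' - I" "H = (\<lambda>k. lower A K k + (H 0 - lower A K 0))"
      using face[OF _ H(1,3) K(1) J'_peaks] a(4) q(1) J'(1) by auto
    have vol: "volume H I + L * int (card A) \<le> volume K J"
      using volume_face[OF K(1) J'_peaks A(2,1,3)] J'_volume by simp
    show "?r q < ?r q'"
    proof (cases "A = {}")
      case True
      then have HK: "H = K" using A(3) H(2) K(2) by simp
      \<comment> \<open>With equal tops the dimension decides: \<open>J'\<close> may contain the
        common summit, but \<open>I\<close> does not.\<close>
      have "I \<subseteq> J" using A(1) J'(2) H(7) HK by auto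
      moreover have "I \<noteq> J" using q(5) HK by simp
      ultimately have "card I < card J" using K(8) by (simp add: psubset_card_mono psubset_eq)
      then show ?thesis using vol True q by simp
    next
      \<comment> \<open>The volume grows by at least \<open>L\<close>, while
        \<open>card I + card A \<le> card J' \<le> card J + 1\<close> with \<open>A\<close> nonempty
        gives \<open>card I \<le> card J\<close>.\<close>
      case False
      have "finite A" using A(2) J'_fin by (meson finite_Diff finite_subset)
      then have cA: "card A \<ge> 1" using False by (simp add: Suc_leI card_gt_0_iff)
      then have "L * 1 \<le> L * int (card A)" using L_pos by (intro mult_left_mono) auto
      then have "volume H I + L \<le> volume K J" using vol by simp
      moreover have "card (I \<union> A) \<le> card J'"
        using A(1,2) by (intro card_mono[OF J'_fin]) blast
      moreover have "card (I \<union> A) = card I + card A"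
        using A(2) by (intro card_Un_disjoint[OF H(8) \<open>finite A\<close>]) blast
      ultimately show ?thesis using J'_card cA L_pos unfolding q by simp
    qed
  qed
  ultimately show ?thesis by simp
qed

end

theorem theorem5p7:
  fixes m n g :: nat
  assumes "m > 0" and "n > 0" and "g > 0"
  shows "collapses_to (TF m n g) {F \<in> TF m n g. thin_flip m n F}"
proof -
  interpret torus m n using assms by unfold_locales
  show ?thesis by (rule collapses_to_thin[OF assms(3)])
qed

end
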